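(* Let $n\ge 2$ and let $v=(v_1,\ldots,v_n)\in\mathbb{N}^n$ with $v_i>0$ for $i=1,\ldots,n$. Then the multinomial lattice $\mathcal{L}(v)$ satisfies the equation $SD_{n-1}(\land)$ and fails the equation $SD_{n-2}(\land)$.
   Context: $\mathbb{N}$ is the set of non-negative integers. For $v=(v_1,\ldots,v_n)\in\mathbb{N}^n$, $\mathcal{L}(v)$ is the set of words over the alphabet $\{a_1,\ldots,a_n\}$ in which each letter $a_i$ occurs exactly $v_i$ times. It is ordered by the reflexive and transitive closure of the relation $\rightarrow$, where $w\rightarrow u$ iff $w=w_1a_ia_jw_2$ and $u=w_1a_ja_iw_2$ for some words $w_1,w_2$ and some $i<j$. This ordered set is a lattice, called a multinomial lattice. Given variables $x,y,z$, define lattice terms by $y_0=y$, $z_0=z$, $y_{m+1}=y\vee(x\land z_m)$, $z_{m+1}=z\vee(x\land y_m)$. For $m\ge 0$, $SD_m(\land)$ is the equation $x\land y_m = x\land(y\vee z)$. A lattice satisfies it if it holds for all values of $x,y,z$ in the lattice, and fails it otherwise. *)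

theory Defs
  imports "HOL-Algebra.Lattice"
begin

text \<open>The letter \<open>a\<^sub>i\<close> is represented by its index \<open>i\<close>, a word by the list of the indices of its
  letters, and a vector in \<open>\<nat>\<^sup>n\<close> by a function on \<open>nat\<close> of which only the values at \<open>1, \<dots>, n\<close>
  are used.\<close>

definition words :: "nat \<Rightarrow> (nat \<Rightarrow> nat) \<Rightarrow> nat list set" where
  "words n v = {w. set w \<subseteq> {1..n} \<and> (\<forall>i\<in>{1..n}. count_list w i = v i)}"

inductive swap_step :: "nat list \<Rightarrow> nat list \<Rightarrow> bool" where
  "i < j \<Longrightarrow> swap_step (w1 @ [i, j] @ w2) (w1 @ [j, i] @ w2)"

definition multinomial_lattice :: "nat \<Rightarrow> (nat \<Rightarrow> nat) \<Rightarrow> nat list gorder" where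
  "multinomial_lattice n v = \<lparr>carrier = words n v, eq = (=), le = swap_step\<^sup>*\<^sup>*\<rparr>"

text \<open>Values of the terms \<open>y\<^sub>m\<close> and \<open>z\<^sub>m\<close> at elements \<open>x\<close>, \<open>y\<close>, \<open>z\<close> of \<open>L\<close>.\<close>

fun y_term z_term :: "('a, 'b) gorder_scheme \<Rightarrow> nat \<Rightarrow> 'a \<Rightarrow> 'a \<Rightarrow> 'a \<Rightarrow> 'a" where
  "y_term L 0 x y z = y"
| "z_term L 0 x y z = z"
| "y_term L (Suc m) x y z = y \<squnion>\<^bsub>L\<^esub> (x \<sqinter>\<^bsub>L\<^esub> z_term L m x y z)"
| "z_term L (Suc m) x y z = z \<squnion>\<^bsub>L\<^esub> (x \<sqinter>\<^bsub>L\<^esub> y_term L m x y z)"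

definition satisfies_SD_meet :: "('a, 'b) gorder_scheme \<Rightarrow> nat \<Rightarrow> bool" where
  "satisfies_SD_meet L m \<longleftrightarrow>
    (\<forall>x\<in>carrier L. \<forall>y\<in>carrier L. \<forall>z\<in>carrier L.
      x \<sqinter>\<^bsub>L\<^esub> y_term L m x y z = x \<sqinter>\<^bsub>L\<^esub> (y \<squnion>\<^bsub>L\<^esub> z))"

end

theory Submission
  imports Defs "HOL-Library.Product_Lexorder"
begin

text \<open>
  A word is determined by its inversions: the pairs \<open>(p, q)\<close> of occurrences of letters, with the
  letter of \<open>p\<close> smaller than that of \<open>q\<close>, such that \<open>q\<close> stands before \<open>p\<close>. As for the weak order on
  permutations, the order of the multinomial lattice is inclusion of inversion sets
  (\<open>swap_steps_iff_word_inversions\<close>), and the inversion sets are exactly the sets that are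
  transitive, have a transitive complement, and contain only pairs of distinct letters
  (\<open>ex_word_inversions\<close>). Hence a join is the transitive closure of a union, and a meet is, dually,
  the largest subset of the intersection with transitive complement
  (\<open>join_word\<close>, \<open>meet_word\<close>). The theorem becomes a statement about chains of pairs.

  \<^bold>\<open>The equation holds at \<open>n - 1\<close>.\<close> Let \<open>W\<close> be the inversion set of \<open>x \<and> (y \<or> z)\<close>. By induction on
  \<open>m\<close>, a pair of \<open>W\<close> whose two letters differ by at most \<open>m\<close> is an inversion of both \<open>y\<^sub>m\<close> and \<open>z\<^sub>m\<close>
  (\<open>meet_join_below_terms\<close>). A pair \<open>(p, q)\<close> of \<open>W\<close> is linked by a chain of inversions of \<open>y\<close> and of
  \<open>z\<close>; because the complement of \<open>W\<close> is transitive, one link \<open>(r, s)\<close> of the chain is such that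
  \<open>(p, r)\<close> and \<open>(s, q)\<close> are again in \<open>W\<close>, when they are not trivial (\<open>trancl_link\<close>). These two have a
  smaller difference of letters, so they are covered by the induction hypothesis, and the single
  link \<open>(r, s)\<close> places \<open>(p, q)\<close> in \<open>y\<^sub>m\<close> or in \<open>z\<^sub>m\<close>; one more step of the recursion carries it
  to the other term. Two letters differ by at most \<open>n - 1\<close>.

  \<^bold>\<open>The equation fails at \<open>n - 2\<close>.\<close> Let \<open>x\<close> invert precisely the letter \<open>1\<close> with all other letters,
  and let \<open>y\<close> and \<open>z\<close> invert precisely the neighbouring letters \<open>i, i + 1\<close>, for \<open>i\<close> of one parity
  each. Then \<open>x \<le> y \<or> z\<close>, but in the recursion each step moves the letter \<open>1\<close> past only one further
  letter, since \<open>y\<close> and \<open>z\<close> contribute their links alternately and the links other than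
  the first are lost under the meet with \<open>x\<close>. If \<open>z\<close> is the one to contribute
  the link from \<open>n - 1\<close> to \<open>n\<close>, then \<open>y\<^bsub>n - 2\<^esub>\<close> does not yet move \<open>1\<close> past \<open>n\<close>.
\<close>

section \<open>Biclosed sets of pairs\<close>

definition increasing_pairs :: "'a::linorder set \<Rightarrow> ('a \<times> 'a) set" where
  "increasing_pairs E = {(p, q). p \<in> E \<and> q \<in> E \<and> p < q}"

definition biclosed :: "'a::linorder set \<Rightarrow> ('a \<times> 'a) set \<Rightarrow> bool" where
  "biclosed E S \<longleftrightarrow> S \<subseteq> increasing_pairs E \<and> trans S \<and> trans (increasing_pairs E - S)"

text \<open>The operation dual to transitive closure, with respect to complements in the set of increasing
  pairs.\<close>

definition interior :: "'a::linorder set \<Rightarrow> ('a \<times> 'a) set \<Rightarrow> ('a \<times> 'a) set" where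
  "interior E S = increasing_pairs E - (increasing_pairs E - S)\<^sup>+"

lemma trans_increasing_pairs: "trans (increasing_pairs E)"
  by (auto simp: increasing_pairs_def intro!: transI)

lemma trancl_subset_of_trans: "r \<subseteq> s \<Longrightarrow> trans s \<Longrightarrow> r\<^sup>+ \<subseteq> s"
  by (metis trancl_id trancl_mono_subset)

lemma biclosed_pairs: "biclosed E S \<Longrightarrow> (p, q) \<in> S \<Longrightarrow> p \<in> E \<and> q \<in> E \<and> p < q"
  by (auto simp: biclosed_def increasing_pairs_def)

lemma biclosed_trans: "biclosed E S \<Longrightarrow> (p, q) \<in> S \<Longrightarrow> (q, r) \<in> S \<Longrightarrow> (p, r) \<in> S"
  by (auto simp: biclosed_def dest: transD)

lemma biclosed_split:
  assumes "biclosed E S" "(p, r) \<in> S" "q \<in> E" "p < q" "q < r"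
  shows "(p, q) \<in> S \<or> (q, r) \<in> S"
proof (rule ccontr)
  assume "\<not> ?thesis"
  moreover have "p \<in> E" "r \<in> E" using biclosed_pairs[OF assms(1,2)] by auto
  ultimately have "(p, q) \<in> increasing_pairs E - S" "(q, r) \<in> increasing_pairs E - S"
    using assms by (auto simp: increasing_pairs_def)
  then have "(p, r) \<in> increasing_pairs E - S"
    using assms(1) unfolding biclosed_def by (blast dest: transD)
  with assms(2) show False by blast
qed

lemma biclosedI:
  assumes "S \<subseteq> increasing_pairs E"
    and "\<And>p q r. (p, q) \<in> S \<Longrightarrow> (q, r) \<in> S \<Longrightarrow> (p, r) \<in> S"
    and "\<And>p q r. (p, r) \<in> S \<Longrightarrow> q \<in> E \<Longrightarrow> p < q \<Longrightarrow> q < r \<Longrightarrow> (p, q) \<in> S \<or> (q, r) \<in> S"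
  shows "biclosed E S"
  unfolding biclosed_def
proof (intro conjI transI)
  fix p q r
  assume "(p, q) \<in> increasing_pairs E - S" "(q, r) \<in> increasing_pairs E - S"
  then show "(p, r) \<in> increasing_pairs E - S"
    using assms(3)[of p r q] by (auto simp: increasing_pairs_def)
qed (use assms in blast)+

lemma biclosed_complement: "biclosed E S \<Longrightarrow> biclosed E (increasing_pairs E - S)"
  by (auto simp: biclosed_def double_diff)

text \<open>A chain from \<open>p\<close> to \<open>r\<close> either passes through the intermediate point \<open>q\<close> or steps over it. In
  the second case the step over \<open>q\<close> lies in one of the two biclosed sets and can be split at \<open>q\<close>.\<close>

lemma biclosed_trancl_Un:
  assumes A: "biclosed E A" and B: "biclosed E B"
  shows "biclosed E ((A \<union> B)\<^sup>+)"
proof (rule biclosedI)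
  show "(A \<union> B)\<^sup>+ \<subseteq> increasing_pairs E"
    using A B by (intro trancl_subset_of_trans trans_increasing_pairs) (auto simp: biclosed_def)
next
  fix p q r
  assume "(p, r) \<in> (A \<union> B)\<^sup>+" "q \<in> E" "p < q" "q < r"
  then show "(p, q) \<in> (A \<union> B)\<^sup>+ \<or> (q, r) \<in> (A \<union> B)\<^sup>+"
  proof (induction rule: trancl_induct)
    case (base r)
    then show ?case using biclosed_split[OF A] biclosed_split[OF B] by blast
  next
    case (step s r)
    consider "q < s" | "q = s" | "s < q" by fastforce
    then show ?case
    proof cases
      case 1
      then show ?thesis using step by (meson trancl.trancl_into_trancl)
    next
      case 2
      then show ?thesis using step by blast
    next
      case 3
      then have "(s, q) \<in> A \<union> B \<or> (q, r) \<in> A \<union> B"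
        using biclosed_split[OF A] biclosed_split[OF B] step by blast
      then show ?thesis using step by (meson r_into_trancl' trancl.trancl_into_trancl)
    qed
  qed
qed (rule trancl_trans)

lemma biclosed_interior_Int:
  assumes "biclosed E A" "biclosed E B"
  shows "biclosed E (interior E (A \<inter> B))"
  using biclosed_complement[OF biclosed_trancl_Un[OF biclosed_complement[OF assms(1)]
        biclosed_complement[OF assms(2)]]]
  by (simp add: interior_def Diff_Int)

lemma interior_subset: "interior E S \<subseteq> S"
  by (auto simp: interior_def)

lemma interior_mono: "S \<subseteq> T \<Longrightarrow> interior E S \<subseteq> interior E T"
  unfolding interior_def by (intro Diff_mono trancl_mono_subset order.refl) auto

lemma interior_greatest:
  assumes "biclosed E C" "C \<subseteq> S"
  shows "C \<subseteq> interior E S"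
proof -
  have "(increasing_pairs E - S)\<^sup>+ \<subseteq> increasing_pairs E - C"
    using assms by (intro trancl_subset_of_trans) (auto simp: biclosed_def)
  then show ?thesis using assms by (auto simp: interior_def biclosed_def)
qed

section \<open>Inversions of a list without repetitions\<close>

fun inversions :: "'a::linorder list \<Rightarrow> ('a \<times> 'a) set" where
  "inversions [] = {}"
| "inversions (p # xs) = {(q, p) |q. q \<in> set xs \<and> q < p} \<union> inversions xs"

lemma inversions_append:
  "inversions (xs @ ys) =
    inversions xs \<union> inversions ys \<union> {(q, p). p \<in> set xs \<and> q \<in> set ys \<and> q < p}"
  by (induction xs) auto

lemma inversions_subset: "inversions xs \<subseteq> increasing_pairs (set xs)"
  by (induction xs) (auto simp: increasing_pairs_def)

lemma inversionsD: "(p, q) \<in> inversions xs \<Longrightarrow> p \<in> set xs \<and> q \<in> set xs \<and> p < q"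
  using inversions_subset by (fastforce simp: increasing_pairs_def)

lemma biclosed_inversions:
  "distinct xs \<Longrightarrow> biclosed (set xs) (inversions xs)"
proof (induction xs)
  case Nil
  then show ?case by (simp add: biclosed_def increasing_pairs_def)
next
  case (Cons a xs)
  then have IH: "biclosed (set xs) (inversions xs)" and a: "a \<notin> set xs" by auto
  show ?case
  proof (rule biclosedI)
    show "inversions (a # xs) \<subseteq> increasing_pairs (set (a # xs))"
      by (rule inversions_subset)
  next
    fix p q r
    assume "(p, q) \<in> inversions (a # xs)" "(q, r) \<in> inversions (a # xs)"
    then show "(p, r) \<in> inversions (a # xs)"
      using a biclosed_trans[OF IH] by (auto dest: inversionsD)
  next
    fix p q r
    assume "(p, r) \<in> inversions (a # xs)" "q \<in> set (a # xs)" "p < q" "q < r"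
    then show "(p, q) \<in> inversions (a # xs) \<or> (q, r) \<in> inversions (a # xs)"
      using a biclosed_split[OF IH, of p r q] by (auto dest: inversionsD)
  qed
qed

lemma inversions_inject:
  assumes "distinct xs" "distinct ys" "set xs = set ys" "inversions xs = inversions ys"
  shows "xs = ys"
  using assms
proof (induction xs arbitrary: ys)
  case Nil
  then show ?case by simp
next
  case (Cons p xs)
  then obtain q ys' where ys: "ys = q # ys'" by (cases ys) auto
  have "p = q"
  proof (rule ccontr)
    assume "p \<noteq> q"
    then have "p \<in> set ys'" "q \<in> set xs" "p \<notin> set xs" "q \<notin> set ys'"
      using Cons.prems ys by auto
    moreover have "(p, q) \<in> inversions (p # xs) \<longleftrightarrow> (p, q) \<in> inversions (q # ys')"
      "(q, p) \<in> inversions (p # xs) \<longleftrightarrow> (q, p) \<in> inversions (q # ys')"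
      using Cons.prems ys by auto
    ultimately show False
      using \<open>p \<noteq> q\<close> by (auto dest: inversionsD)
  qed
  moreover have "inversions xs = inversions ys'"
  proof -
    have "inversions (p # xs) - {(r, p) |r. True} = inversions xs"
      "inversions (q # ys') - {(r, q) |r. True} = inversions ys'"
      using Cons.prems ys by (auto dest: inversionsD)
    then show ?thesis using Cons.prems ys \<open>p = q\<close> by auto
  qed
  moreover have "set xs = set ys'"
    using Cons.prems ys \<open>p = q\<close> by auto
  ultimately show ?case using Cons ys by auto
qed

lemma ex_sorted_wrt:
  assumes "finite A" "\<And>p q r. R p q \<Longrightarrow> R q r \<Longrightarrow> R p r"
    and "\<And>p q. p \<in> A \<Longrightarrow> q \<in> A \<Longrightarrow> p \<noteq> q \<Longrightarrow> R p q \<or> R q p"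
  shows "\<exists>xs. distinct xs \<and> set xs = A \<and> sorted_wrt R xs"
  using assms(1,3)
proof (induction A)
  case empty
  then show ?case by simp
next
  case (insert x A)
  then obtain xs where xs: "distinct xs" "set xs = A" "sorted_wrt R xs" by auto
  let ?ys = "filter (\<lambda>y. R y x) xs @ x # filter (\<lambda>y. \<not> R y x) xs"
  have "\<And>y. y \<in> A \<Longrightarrow> \<not> R y x \<Longrightarrow> R x y" using insert by blast
  then have "distinct ?ys \<and> set ?ys = insert x A \<and> sorted_wrt R ?ys"
    using xs insert.hyps assms(2)
    by (auto simp: sorted_wrt_append sorted_wrt_filter)
  then show ?case by blast
qed

lemma inversions_sorted_wrt:
  assumes "\<And>p q. R p q \<Longrightarrow> \<not> R q p" "sorted_wrt R xs"
  shows "inversions xs = {(q, p). q \<in> set xs \<and> p \<in> set xs \<and> q < p \<and> R p q}"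
  using assms(2)
proof (induction xs)
  case Nil
  then show ?case by simp
next
  case (Cons a xs)
  then show ?case using assms(1) by auto
qed

text \<open>Biclosed sets are precisely the inversion sets of permutations: reversing the pairs of \<open>S\<close> in the
  given order yields again a linear order, and the list sorted by it has the inversions \<open>S\<close>.
  Transitivity of the new order is immediate from the two closure properties when both steps are
  of the same kind, and follows by comparing \<open>p\<close> and \<open>r\<close> when exactly one is reversed.\<close>

lemma ex_inversions:
  assumes "finite E" and S: "biclosed E S"
  obtains xs where "distinct xs" "set xs = E" "inversions xs = S"
proof -
  let ?T = "increasing_pairs E - S"
  define R where "R p q \<longleftrightarrow> (q, p) \<in> S \<or> (p, q) \<in> ?T" for p q
  note T = biclosed_complement[OF S]
  have disj: "(p, q) \<in> S \<Longrightarrow> (p, q) \<in> ?T \<Longrightarrow> False" for p q by blast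
  have tot: "p \<in> E \<Longrightarrow> q \<in> E \<Longrightarrow> p < q \<Longrightarrow> (p, q) \<in> S \<or> (p, q) \<in> ?T" for p q
    by (auto simp: increasing_pairs_def)
  have mixed: "R p r" if "(q, p) \<in> S" "(q, r) \<in> ?T" for p q r
  proof -
    have E: "p \<in> E" "q \<in> E" "r \<in> E"
      using that biclosed_pairs[OF S] biclosed_pairs[OF T] by blast+
    consider "p < r" | "p = r" | "r < p" by fastforce
    then show ?thesis
    proof cases
      case 1
      then show ?thesis using tot[OF E(1,3)] biclosed_trans[OF S] that disj by (metis R_def)
    next
      case 2
      then show ?thesis using that disj by blast
    next
      case 3
      then show ?thesis using tot[OF E(3,1)] biclosed_trans[OF T] that disj by (metis R_def)
    qed
  qed
  have mixed': "R p r" if "(p, q) \<in> ?T" "(r, q) \<in> S" for p q r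
  proof -
    have E: "p \<in> E" "q \<in> E" "r \<in> E"
      using that biclosed_pairs[OF S] biclosed_pairs[OF T] by blast+
    consider "p < r" | "p = r" | "r < p" by fastforce
    then show ?thesis
    proof cases
      case 1
      then show ?thesis using tot[OF E(1,3)] biclosed_trans[OF S] that disj by (metis R_def)
    next
      case 2
      then show ?thesis using that disj by blast
    next
      case 3
      then show ?thesis using tot[OF E(3,1)] biclosed_trans[OF T] that disj by (metis R_def)
    qed
  qed
  have trans: "R p r" if "R p q" "R q r" for p q r
    using that mixed mixed' biclosed_trans[OF S] biclosed_trans[OF T] unfolding R_def by blast
  have asym: "\<not> R q p" if "R p q" for p q
    using that biclosed_pairs[OF S] biclosed_pairs[OF T] unfolding R_def
    by (meson DiffE order_less_asym)
  have "\<exists>xs. distinct xs \<and> set xs = E \<and> sorted_wrt R xs"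
    using assms(1) trans
  proof (rule ex_sorted_wrt)
    fix p q assume "p \<in> E" "q \<in> E" "p \<noteq> q"
    then show "R p q \<or> R q p" using tot unfolding R_def by (meson linorder_neqE)
  qed
  then obtain xs where xs: "distinct xs" "set xs = E" "sorted_wrt R xs" by blast
  have "inversions xs = {(q, p). q \<in> E \<and> p \<in> E \<and> q < p \<and> R p q}"
    using inversions_sorted_wrt[of R xs] asym xs(2,3) by simp
  also have "\<dots> = S"
    using biclosed_pairs[OF S] by (auto simp: R_def increasing_pairs_def)
  finally show ?thesis using xs that by blast
qed

section \<open>Inversion sets of words\<close>

text \<open>Equal letters are made distinct by pairing the letter \<open>i\<close> with a number that counts its
  occurrences upwards from \<open>c i\<close>. In the lexicographic order, two occurrences of the same letter
  then never form an inversion.\<close>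

fun occurrences :: "(nat \<Rightarrow> nat) \<Rightarrow> nat list \<Rightarrow> (nat \<times> nat) list" where
  "occurrences c [] = []"
| "occurrences c (i # w) = (i, c i) # occurrences (c(i := Suc (c i))) w"

lemma map_fst_occurrences: "map fst (occurrences c w) = w"
  by (induction w arbitrary: c) auto

lemma set_occurrences:
  "set (occurrences c w) = {(i, k). c i \<le> k \<and> k < c i + count_list w i}"
  by (induction w arbitrary: c) (auto split: if_splits)

lemma distinct_occurrences: "distinct (occurrences c w)"
  by (induction w arbitrary: c) (auto simp: set_occurrences)

lemma occurrences_append:
  "occurrences c (u @ w) = occurrences c u @ occurrences (\<lambda>i. c i + count_list u i) w"
proof (induction u arbitrary: c)
  case (Cons a u)
  have "(\<lambda>i. (c(a := Suc (c a))) i + count_list u i) = (\<lambda>i. c i + count_list (a # u) i)"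
    by auto
  then show ?case by (simp only: append_Cons occurrences.simps Cons.IH)
qed simp

lemma inversions_occurrences_fst:
  "(p, q) \<in> inversions (occurrences c w) \<Longrightarrow> fst p < fst q"
  by (induction w arbitrary: c) (auto simp: set_occurrences less_prod_def' split: if_splits)

text \<open>The numbering can be recovered from the letters: if \<open>xs\<close> begins with the letter \<open>i\<close>, then it begins
  with \<open>(i, c i)\<close>, because this element would otherwise follow and give an inversion of equal letters.\<close>

lemma occurrences_map_fst:
  assumes "distinct xs" and "set xs = {(i, k). c i \<le> k \<and> k < c i + d i}"
    and "\<And>p q. (p, q) \<in> inversions xs \<Longrightarrow> fst p < fst q"
  shows "occurrences c (map fst xs) = xs"
  using assms
proof (induction xs arbitrary: c d)
  case Nil
  then show ?case by simp
next
  case (Cons p xs)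
  obtain i k where p: "p = (i, k)" by fastforce
  have k: "c i \<le> k" "k < c i + d i" using Cons.prems(2) p by auto
  have "k = c i"
  proof (rule ccontr)
    assume "k \<noteq> c i"
    then have "(i, c i) \<in> set (p # xs)" "(i, c i) < (i, k)"
      using Cons.prems(2) k by auto
    then have "((i, c i), (i, k)) \<in> inversions (p # xs)" using p by auto
    then show False using Cons.prems(3) by fastforce
  qed
  have "set xs = set (p # xs) - {p}" using Cons.prems(1) by auto
  also have "\<dots> = {(j, l). (c(i := Suc (c i))) j \<le> l \<and>
      l < (c(i := Suc (c i))) j + (d(i := d i - 1)) j}"
    unfolding Cons.prems(2) using p \<open>k = c i\<close> k by (auto split: if_splits)
  finally have "occurrences (c(i := Suc (c i))) (map fst xs) = xs"
    by (rule Cons.IH[rotated]) (use Cons.prems(1,3) in auto)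
  then show ?case using p \<open>k = c i\<close> by simp
qed

definition word_inversions :: "nat list \<Rightarrow> ((nat \<times> nat) \<times> (nat \<times> nat)) set" where
  "word_inversions w = inversions (occurrences (\<lambda>_. 0) w)"

definition positions :: "nat \<Rightarrow> (nat \<Rightarrow> nat) \<Rightarrow> (nat \<times> nat) set" where
  "positions n v = {(i, k). i \<in> {1..n} \<and> k < v i}"

definition letter_pairs :: "((nat \<times> nat) \<times> (nat \<times> nat)) set" where
  "letter_pairs = {(p, q). fst p < fst q}"

lemma trans_letter_pairs: "trans letter_pairs"
  by (auto simp: letter_pairs_def intro!: transI)

lemma finite_positions: "finite (positions n v)"
proof -
  have "positions n v = (SIGMA i:{1..n}. {..<v i})" by (auto simp: positions_def)
  then show ?thesis by auto
qed

lemma words_iff: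
  "w \<in> words n v \<longleftrightarrow> set (occurrences (\<lambda>_. 0) w) = positions n v"
proof
  assume w: "w \<in> words n v"
  have "count_list w i = (if i \<in> {1..n} then v i else 0)" for i
    using w by (auto simp: words_def count_list_0_iff)
  then show "set (occurrences (\<lambda>_. 0) w) = positions n v"
    by (auto simp: set_occurrences positions_def split: if_splits)
next
  assume eq: "set (occurrences (\<lambda>_. 0) w) = positions n v"
  have *: "k < count_list w i \<longleftrightarrow> i \<in> {1..n} \<and> k < v i" for i k
    using eq by (auto simp: set_occurrences positions_def set_eq_iff)
  have "i \<in> {1..n}" if "i \<in> set w" for i
    using *[of 0 i] that by (metis count_list_0_iff gr0I)
  moreover have "count_list w i = v i" if "i \<in> {1..n}" for i
    using *[of "count_list w i" i] *[of "v i" i] that by auto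
  ultimately show "w \<in> words n v" by (auto simp: words_def)
qed

lemma biclosed_word_inversions:
  "w \<in> words n v \<Longrightarrow> biclosed (positions n v) (word_inversions w)"
  using biclosed_inversions[OF distinct_occurrences] words_iff
  unfolding word_inversions_def by metis

lemma word_inversions_letter_pairs: "word_inversions w \<subseteq> letter_pairs"
  by (auto simp: word_inversions_def letter_pairs_def dest: inversions_occurrences_fst)

lemma word_inversions_inject:
  assumes "u \<in> words n v" "w \<in> words n v" "word_inversions u = word_inversions w"
  shows "u = w"
proof -
  have "occurrences (\<lambda>_. 0) u = occurrences (\<lambda>_. 0) w"
    using assms unfolding words_iff word_inversions_def
    by (intro inversions_inject distinct_occurrences) auto
  then show ?thesis by (metis map_fst_occurrences)
qed

text \<open>The list that realizes \<open>S\<close> has the occurrences of each letter in their original order, since \<open>S\<close>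
  has no pair of equal letters; so it is the numbering of a word.\<close>

lemma ex_word_inversions:
  assumes "biclosed (positions n v) S" "S \<subseteq> letter_pairs"
  obtains w where "w \<in> words n v" "word_inversions w = S"
proof -
  obtain xs where xs: "distinct xs" "set xs = positions n v" "inversions xs = S"
    using ex_inversions[OF finite_positions assms(1)] by blast
  have "occurrences (\<lambda>_. 0) (map fst xs) = xs"
    using xs assms(2)
    by (intro occurrences_map_fst[where d = "\<lambda>i. if i \<in> {1..n} then v i else 0"])
      (auto simp: positions_def letter_pairs_def split: if_splits)
  then show ?thesis using that[of "map fst xs"] xs by (simp add: words_iff word_inversions_def)
qed

section \<open>Swaps and inclusion of inversion sets\<close>

lemma word_inversions_swap_step:
  "swap_step u w \<Longrightarrow> word_inversions u \<subseteq> word_inversions w"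
proof (induction rule: swap_step.induct)
  case (1 i j w1 w2)
  define c d where "c = count_list w1" and "d = (\<lambda>k. c k + count_list [i, j] k)"
  have d: "d = (\<lambda>k. c k + count_list [j, i] k)" by (auto simp: d_def)
  have "occurrences (\<lambda>_. 0) (w1 @ [i, j] @ w2) =
      occurrences (\<lambda>_. 0) w1 @ [(i, c i), (j, c j)] @ occurrences d w2"
    using 1 by (simp only: occurrences_append d_def c_def add_0) simp
  moreover have "occurrences (\<lambda>_. 0) (w1 @ [j, i] @ w2) =
      occurrences (\<lambda>_. 0) w1 @ [(j, c j), (i, c i)] @ occurrences d w2"
    using 1 by (simp only: occurrences_append d c_def add_0) simp
  ultimately show ?case
    using 1 unfolding word_inversions_def by (auto simp: inversions_append)
qed

lemma swap_step_Cons: "swap_step u w \<Longrightarrow> swap_step (i # u) (i # w)"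
proof (induction rule: swap_step.induct)
  case (1 k l w1 w2)
  then show ?case using swap_step.intros[of k l "i # w1" w2] by simp
qed

lemma swap_steps_Cons: "swap_step\<^sup>*\<^sup>* u w \<Longrightarrow> swap_step\<^sup>*\<^sup>* (i # u) (i # w)"
proof (induction rule: rtranclp_induct)
  case (step w w')
  then show ?case using swap_step_Cons[of w w' i] by (meson rtranclp.rtrancl_into_rtrancl)
qed simp

lemma swap_steps_move_right:
  "(\<And>j. j \<in> set u \<Longrightarrow> i < j) \<Longrightarrow> swap_step\<^sup>*\<^sup>* (i # u @ w) (u @ i # w)"
proof (induction u)
  case (Cons j u)
  have "swap_step (i # j # u @ w) (j # i # u @ w)"
    using swap_step.intros[of i j "[]" "u @ w"] Cons.prems by simp
  moreover have "swap_step\<^sup>*\<^sup>* (j # i # u @ w) (j # u @ i # w)"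
    using Cons by (intro swap_steps_Cons) auto
  ultimately show ?case by simp
qed simp

text \<open>Let \<open>p\<close> be the first element of the smaller list. Whatever stands before \<open>p\<close> in \<open>ys\<close> is inverted with
  \<open>p\<close> there, hence has a larger letter, so \<open>p\<close> can be moved to its place by swaps once the
  remaining elements are arranged as in \<open>ys\<close>.\<close>

lemma swap_steps_of_inversions:
  fixes xs ys :: "(nat \<times> nat) list"
  assumes "distinct xs" "distinct ys" "set xs = set ys" "inversions xs \<subseteq> inversions ys"
    and "inversions ys \<subseteq> letter_pairs"
  shows "swap_step\<^sup>*\<^sup>* (map fst xs) (map fst ys)"
  using assms
proof (induction xs arbitrary: ys)
  case Nil
  then show ?case by simp
next
  case (Cons p xs)
  then obtain us ws where ys: "ys = us @ p # ws" by (metis list.set_intros(1) split_list)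
  have less: "fst p < fst r" if r: "r \<in> set us" for r
  proof -
    have "r \<noteq> p" "r \<in> set xs" "r \<notin> set ws" "p \<notin> set us" "p \<notin> set ws"
      using r Cons.prems(1-3) ys by auto
    have "\<not> r < p"
    proof
      assume "r < p"
      then have "(r, p) \<in> inversions (p # xs)" using \<open>r \<in> set xs\<close> by (cases r) simp
      then have "(r, p) \<in> inversions ys" using Cons.prems(4) by blast
      then show False
        using ys r \<open>r \<notin> set ws\<close> \<open>p \<notin> set us\<close> \<open>p \<notin> set ws\<close>
        by (auto simp: inversions_append dest: inversionsD)
    qed
    then have "(p, r) \<in> inversions ys"
      using \<open>r \<noteq> p\<close> r ys by (auto simp: inversions_append)
    then show ?thesis using Cons.prems(5) by (auto simp: letter_pairs_def)
  qed
  have "swap_step\<^sup>*\<^sup>* (map fst xs) (map fst (us @ ws))"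
  proof (rule Cons.IH)
    show "set xs = set (us @ ws)" using Cons.prems(1-3) ys by auto
    show "inversions xs \<subseteq> inversions (us @ ws)"
    proof (rule subrelI)
      fix q r assume qr: "(q, r) \<in> inversions xs"
      then have "q \<noteq> p" "r \<noteq> p" using Cons.prems(1) by (auto dest: inversionsD)
      moreover have "(q, r) \<in> inversions ys" using qr Cons.prems(4) by auto
      ultimately show "(q, r) \<in> inversions (us @ ws)"
        using ys by (auto simp: inversions_append)
    qed
    show "inversions (us @ ws) \<subseteq> letter_pairs"
      using Cons.prems(5) ys by (auto simp: inversions_append)
  qed (use Cons.prems ys in auto)
  then have "swap_step\<^sup>*\<^sup>* (map fst (p # xs)) (fst p # map fst us @ map fst ws)"
    by (auto dest: swap_steps_Cons)
  also have "swap_step\<^sup>*\<^sup>* \<dots> (map fst us @ fst p # map fst ws)"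
    using less by (intro swap_steps_move_right) auto
  finally show ?case using ys by simp
qed

lemma swap_steps_iff_word_inversions:
  assumes "u \<in> words n v" "w \<in> words n v"
  shows "swap_step\<^sup>*\<^sup>* u w \<longleftrightarrow> word_inversions u \<subseteq> word_inversions w"
proof
  assume "swap_step\<^sup>*\<^sup>* u w"
  then show "word_inversions u \<subseteq> word_inversions w"
    by (induction rule: rtranclp_induct) (use word_inversions_swap_step in blast)+
next
  assume "word_inversions u \<subseteq> word_inversions w"
  then have "swap_step\<^sup>*\<^sup>* (map fst (occurrences (\<lambda>_. 0) u)) (map fst (occurrences (\<lambda>_. 0) w))"
    using assms word_inversions_letter_pairs[of w] unfolding words_iff word_inversions_def
    by (intro swap_steps_of_inversions distinct_occurrences) auto
  then show "swap_step\<^sup>*\<^sup>* u w" by (simp add: map_fst_occurrences)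
qed

section \<open>Joins and meets in the multinomial lattice\<close>

lemma carrier_multinomial_lattice [simp]: "carrier (multinomial_lattice n v) = words n v"
  by (simp add: multinomial_lattice_def)

lemma le_multinomial_lattice:
  assumes "u \<in> words n v" "w \<in> words n v"
  shows "u \<sqsubseteq>\<^bsub>multinomial_lattice n v\<^esub> w \<longleftrightarrow> word_inversions u \<subseteq> word_inversions w"
  using swap_steps_iff_word_inversions[OF assms] by (simp add: multinomial_lattice_def)

lemma partial_order_multinomial_lattice: "partial_order (multinomial_lattice n v)"
proof -
  have eq: "(.=\<^bsub>multinomial_lattice n v\<^esub>) = (=)"
    by (simp add: multinomial_lattice_def)
  show ?thesis
    by unfold_locales (auto simp: eq le_multinomial_lattice intro: word_inversions_inject)
qed

lemma least_multinomial_lattice: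
  assumes "a \<in> words n v" "b \<in> words n v" "c \<in> words n v"
    and "word_inversions c = (word_inversions a \<union> word_inversions b)\<^sup>+"
  shows "least (multinomial_lattice n v) c (Upper (multinomial_lattice n v) {a, b})"
proof -
  have "word_inversions c \<subseteq> word_inversions d"
    if "d \<in> words n v" "word_inversions a \<subseteq> word_inversions d"
      "word_inversions b \<subseteq> word_inversions d" for d
    unfolding assms(4) using that biclosed_word_inversions[OF that(1)]
    by (intro trancl_subset_of_trans) (auto simp: biclosed_def)
  note lub = this
  have ub: "word_inversions a \<subseteq> word_inversions c" "word_inversions b \<subseteq> word_inversions c"
    unfolding assms(4) by auto
  show ?thesis
  proof (rule least_UpperI)
    fix d assume "d \<in> Upper (multinomial_lattice n v) {a, b}"
    then have "d \<in> words n v" "a \<sqsubseteq>\<^bsub>multinomial_lattice n v\<^esub> d" "b \<sqsubseteq>\<^bsub>multinomial_lattice n v\<^esub> d"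
      using assms(1,2) by (auto simp: Upper_def)
    then show "c \<sqsubseteq>\<^bsub>multinomial_lattice n v\<^esub> d"
      using lub assms(1-3) by (simp add: le_multinomial_lattice)
  qed (use ub assms(1-3) in \<open>auto simp: le_multinomial_lattice\<close>)
qed

lemma greatest_multinomial_lattice:
  assumes "a \<in> words n v" "b \<in> words n v" "c \<in> words n v"
    and "word_inversions c = interior (positions n v) (word_inversions a \<inter> word_inversions b)"
  shows "greatest (multinomial_lattice n v) c (Lower (multinomial_lattice n v) {a, b})"
proof -
  have "word_inversions d \<subseteq> word_inversions c"
    if "d \<in> words n v" "word_inversions d \<subseteq> word_inversions a"
      "word_inversions d \<subseteq> word_inversions b" for d
    unfolding assms(4) using that biclosed_word_inversions[OF that(1)]
    by (intro interior_greatest) auto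
  note glb = this
  have lb: "word_inversions c \<subseteq> word_inversions a" "word_inversions c \<subseteq> word_inversions b"
    unfolding assms(4) using interior_subset by blast+
  show ?thesis
  proof (rule greatest_LowerI)
    fix d assume "d \<in> Lower (multinomial_lattice n v) {a, b}"
    then have "d \<in> words n v" "d \<sqsubseteq>\<^bsub>multinomial_lattice n v\<^esub> a" "d \<sqsubseteq>\<^bsub>multinomial_lattice n v\<^esub> b"
      using assms(1,2) by (auto simp: Lower_def)
    then show "d \<sqsubseteq>\<^bsub>multinomial_lattice n v\<^esub> c"
      using glb assms(1-3) by (simp add: le_multinomial_lattice)
  qed (use lb assms(1-3) in \<open>auto simp: le_multinomial_lattice\<close>)
qed

lemma ex_join_word:
  assumes "a \<in> words n v" "b \<in> words n v"
  obtains c where "c \<in> words n v" "word_inversions c = (word_inversions a \<union> word_inversions b)\<^sup>+"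
proof -
  have "(word_inversions a \<union> word_inversions b)\<^sup>+ \<subseteq> letter_pairs"
    using word_inversions_letter_pairs trans_letter_pairs
    by (intro trancl_subset_of_trans) auto
  then show ?thesis
    using that ex_word_inversions biclosed_trancl_Un biclosed_word_inversions assms by metis
qed

lemma ex_meet_word:
  assumes "a \<in> words n v" "b \<in> words n v"
  obtains c where "c \<in> words n v"
    "word_inversions c = interior (positions n v) (word_inversions a \<inter> word_inversions b)"
proof -
  have "interior (positions n v) (word_inversions a \<inter> word_inversions b) \<subseteq> letter_pairs"
    using word_inversions_letter_pairs interior_subset by blast
  then show ?thesis
    using that ex_word_inversions biclosed_interior_Int biclosed_word_inversions assms by metis
qed

lemma lattice_multinomial_lattice: "Lattice.lattice (multinomial_lattice n v)"
proof -
  interpret partial_order "multinomial_lattice n v"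
    by (rule partial_order_multinomial_lattice)
  show ?thesis
  proof unfold_locales
    fix a b assume "a \<in> carrier (multinomial_lattice n v)" "b \<in> carrier (multinomial_lattice n v)"
    then have ab: "a \<in> words n v" "b \<in> words n v" by auto
    show "\<exists>s. least (multinomial_lattice n v) s (Upper (multinomial_lattice n v) {a, b})"
      using ex_join_word[OF ab] least_multinomial_lattice[OF ab] by metis
    show "\<exists>s. greatest (multinomial_lattice n v) s (Lower (multinomial_lattice n v) {a, b})"
      using ex_meet_word[OF ab] greatest_multinomial_lattice[OF ab] by metis
  qed
qed

lemma join_word:
  assumes "a \<in> words n v" "b \<in> words n v"
  shows "a \<squnion>\<^bsub>multinomial_lattice n v\<^esub> b \<in> words n v"
    and "word_inversions (a \<squnion>\<^bsub>multinomial_lattice n v\<^esub> b) =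
      (word_inversions a \<union> word_inversions b)\<^sup>+"
proof -
  interpret Lattice.lattice "multinomial_lattice n v" by (rule lattice_multinomial_lattice)
  obtain c where c: "c \<in> words n v" "word_inversions c = (word_inversions a \<union> word_inversions b)\<^sup>+"
    using ex_join_word[OF assms] .
  have "a \<squnion>\<^bsub>multinomial_lattice n v\<^esub> b = c"
    by (rule joinI) (use assms least_unique least_multinomial_lattice[OF assms c] in auto)
  with c show "a \<squnion>\<^bsub>multinomial_lattice n v\<^esub> b \<in> words n v"
    "word_inversions (a \<squnion>\<^bsub>multinomial_lattice n v\<^esub> b) =
      (word_inversions a \<union> word_inversions b)\<^sup>+" by auto
qed

lemma meet_word:
  assumes "a \<in> words n v" "b \<in> words n v"
  shows "a \<sqinter>\<^bsub>multinomial_lattice n v\<^esub> b \<in> words n v"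
    and "word_inversions (a \<sqinter>\<^bsub>multinomial_lattice n v\<^esub> b) =
      interior (positions n v) (word_inversions a \<inter> word_inversions b)"
proof -
  interpret Lattice.lattice "multinomial_lattice n v" by (rule lattice_multinomial_lattice)
  obtain c where c: "c \<in> words n v"
    "word_inversions c = interior (positions n v) (word_inversions a \<inter> word_inversions b)"
    using ex_meet_word[OF assms] .
  have "a \<sqinter>\<^bsub>multinomial_lattice n v\<^esub> b = c"
    by (rule meetI) (use assms greatest_unique greatest_multinomial_lattice[OF assms c] in auto)
  with c show "a \<sqinter>\<^bsub>multinomial_lattice n v\<^esub> b \<in> words n v"
    "word_inversions (a \<sqinter>\<^bsub>multinomial_lattice n v\<^esub> b) =
      interior (positions n v) (word_inversions a \<inter> word_inversions b)" by auto
qed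

lemma term_words:
  assumes "x \<in> words n v" "y \<in> words n v" "z \<in> words n v"
  shows "y_term (multinomial_lattice n v) m x y z \<in> words n v"
    and "z_term (multinomial_lattice n v) m x y z \<in> words n v"
  by (induction m) (use assms join_word(1) meet_word(1) in auto)

section \<open>The equation holds at n - 1\<close>

text \<open>Take the last point \<open>r\<close> of the chain before \<open>q\<close> with \<open>r = p\<close> or \<open>(p, r)\<close> in \<open>W\<close>, and its successor \<open>s\<close>.
  If \<open>s\<close> is not \<open>q\<close>, then \<open>(p, s)\<close> is not in \<open>W\<close>, so \<open>(s, q)\<close> is, as \<open>W\<close> splits \<open>(p, q)\<close> at \<open>s\<close>.\<close>

lemma trancl_link:
  assumes W: "biclosed E W" and R: "R \<subseteq> increasing_pairs E"
    and "(p, q) \<in> R\<^sup>+" "(p, q) \<in> W"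
  obtains r s where "r = p \<or> (p, r) \<in> R\<^sup>+ \<inter> W" "(r, s) \<in> R" "s = q \<or> (s, q) \<in> R\<^sup>+ \<inter> W"
proof -
  have Rp: "a \<in> E \<and> b \<in> E \<and> a < b" if "(a, b) \<in> R\<^sup>+" for a b
    using trancl_subset_of_trans[OF R trans_increasing_pairs] that
    by (auto simp: increasing_pairs_def)
  \<comment> \<open>The induction runs over initial parts of the chain and keeps its end \<open>t\<close> fixed.\<close>
  have "\<exists>r s. (r = p \<or> (p, r) \<in> R\<^sup>+ \<inter> W) \<and> (r, s) \<in> R \<and> (s = t \<or> (s, t) \<in> R\<^sup>+ \<inter> W)"
    if "(p, q) \<in> R\<^sup>+" "(p, t) \<in> W" "q = t \<or> (q, t) \<in> R\<^sup>+ \<inter> W" for q t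
    using that
  proof (induction rule: trancl_induct)
    case (base q)
    then show ?case by blast
  next
    case (step r q)
    show ?case
    proof (cases "(p, r) \<in> W")
      case True
      then show ?thesis using step by blast
    next
      case False
      have rt: "(r, t) \<in> R\<^sup>+" using step by (meson IntD1 r_into_trancl' trancl_trans)
      have "(r, t) \<in> W"
        using biclosed_split[OF W step.prems(1)] Rp[OF step.hyps(1)] Rp[OF rt] False by blast
      then show ?thesis using step rt by blast
    qed
  qed
  with assms(3,4) that show ?thesis by blast
qed

text \<open>Membership in a meet can be tested on \<open>W\<close>: every chain from \<open>p\<close> to \<open>q\<close> has a step in \<open>W\<close>, since the
  complement of \<open>W\<close> is transitive. If \<open>S\<close> contains this step, the chain does not avoid \<open>S\<close>.\<close>

lemma interior_mem:
  assumes W: "biclosed E W" and "(p, q) \<in> W"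
    and S: "\<And>r s. (r, s) \<in> W \<Longrightarrow> p \<le> r \<Longrightarrow> s \<le> q \<Longrightarrow> (r, s) \<in> S"
  shows "(p, q) \<in> interior E S"
proof (rule ccontr)
  assume "(p, q) \<notin> interior E S"
  then have "(p, q) \<in> (increasing_pairs E - S)\<^sup>+"
    using assms(1,2) by (auto simp: interior_def biclosed_def)
  have *: "\<exists>r s. (r, s) \<in> W - S \<and> p \<le> r \<and> s \<le> q"
    if "(p, q) \<in> (increasing_pairs E - S)\<^sup>+" "(p, q) \<in> W" for q
    using that
  proof (induction rule: trancl_induct)
    case (base q)
    then show ?case by blast
  next
    case (step r q)
    have "(p, r) \<in> increasing_pairs E"
      using step.hyps(1) trancl_subset_of_trans[OF _ trans_increasing_pairs] by blast
    then have "p < r" "r < q" "r \<in> E" using step.hyps by (auto simp: increasing_pairs_def)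
    with biclosed_split[OF W step.prems] consider "(p, r) \<in> W" | "(r, q) \<in> W" by blast
    then show ?case
    proof cases
      case 1
      then show ?thesis using step.IH \<open>r < q\<close> by (meson order.trans order_less_imp_le)
    next
      case 2
      then show ?thesis using step.hyps(2) \<open>p < r\<close> by (meson DiffD2 DiffI order.refl order_less_imp_le)
    qed
  qed
  show False using *[OF \<open>(p, q) \<in> (increasing_pairs E - S)\<^sup>+\<close> assms(2)] S by blast
qed

text \<open>Between \<open>p\<close> and \<open>q\<close>, changing to a later occurrence of the first letter or to an earlier one of the
  second cannot undo an inversion, as the occurrences of one letter keep their order in the
  word.\<close>

lemma same_letters:
  assumes S: "biclosed E S" "S \<subseteq> letter_pairs" and "(p, q) \<in> S" "r \<in> E" "s \<in> E"
    and "p \<le> r" "s \<le> q" "fst r = fst p" "fst s = fst q"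
  shows "(r, s) \<in> S"
proof -
  have "(p, r) \<notin> S" "(s, q) \<notin> S" using assms by (auto simp: letter_pairs_def)
  have "fst p < fst q" using assms(2,3) by (auto simp: letter_pairs_def)
  then have "r < q" "r < s" using assms by (auto simp: less_prod_def)
  have "(r, q) \<in> S"
    using biclosed_split[OF S(1) assms(3,4)] \<open>p \<le> r\<close> \<open>r < q\<close> \<open>(p, r) \<notin> S\<close> assms(3)
    by (metis order_le_less)
  then show ?thesis
    using biclosed_split[OF S(1) _ assms(5)] \<open>s \<le> q\<close> \<open>r < s\<close> \<open>(s, q) \<notin> S\<close>
    by (metis order_le_less)
qed

text \<open>\<open>Y m\<close> and \<open>Z m\<close> are the inversion sets of \<open>y\<^sub>m\<close> and \<open>z\<^sub>m\<close>, and \<open>W\<close> is that of \<open>x \<and> (y \<or> z)\<close>.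
  The induction step first puts \<open>(p, q)\<close> in one of \<open>Y m\<close> and \<open>Z m\<close>, depending on the origin of the
  link \<open>(r, s)\<close>, and then crosses over to the other sequence in step \<open>m + 1\<close>.\<close>

lemma meet_join_below_terms:
  fixes E :: "(nat \<times> nat) set" and Y Z :: "nat \<Rightarrow> ((nat \<times> nat) \<times> (nat \<times> nat)) set"
  assumes W: "biclosed E W" "W \<subseteq> letter_pairs" "W \<subseteq> X" "W \<subseteq> (Y 0 \<union> Z 0)\<^sup>+"
    and Y: "\<And>m. biclosed E (Y m)" "\<And>m. Y m \<subseteq> letter_pairs"
      "\<And>m. Y (Suc m) = (Y 0 \<union> interior E (X \<inter> Z m))\<^sup>+"
    and Z: "\<And>m. biclosed E (Z m)" "\<And>m. Z m \<subseteq> letter_pairs"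
      "\<And>m. Z (Suc m) = (Z 0 \<union> interior E (X \<inter> Y m))\<^sup>+"
    and pq: "(p, q) \<in> W" "fst q \<le> fst p + m"
  shows "(p, q) \<in> Y m \<inter> Z m"
  using pq
proof (induction m arbitrary: p q)
  case 0
  then show ?case using W(2) by (auto simp: letter_pairs_def)
next
  case (Suc m)
  have mono: "Y m \<subseteq> Y (Suc m) \<and> Z m \<subseteq> Z (Suc m)" for m
  proof (induction m)
    case 0
    then show ?case using Y(3) Z(3) by auto
  next
    case (Suc m)
    have "A \<subseteq> B \<Longrightarrow> interior E (X \<inter> A) \<subseteq> interior E (X \<inter> B)" for A B
      by (intro interior_mono) auto
    with Suc show ?case
      unfolding Y(3)[of m] Z(3)[of m] Y(3)[of "Suc m"] Z(3)[of "Suc m"]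
      by (intro conjI trancl_mono_subset Un_mono order.refl) auto
  qed
  have Y0: "Y 0 \<subseteq> Y m" for m
    by (cases m) (use Y(3) in auto)
  have Z0: "Z 0 \<subseteq> Z m" for m
    by (cases m) (use Z(3) in auto)
  let ?R = "Y 0 \<union> Z 0"
  have R: "?R \<subseteq> increasing_pairs E" "?R \<subseteq> letter_pairs"
    using Y(1,2) Z(1,2) by (auto simp: biclosed_def)
  have Rlt: "fst a < fst b" if "(a, b) \<in> ?R\<^sup>+" for a b
    using that trancl_subset_of_trans[OF R(2) trans_letter_pairs] by (auto simp: letter_pairs_def)
  \<comment> \<open>This crosses over. A pair of \<open>W\<close> between \<open>p\<close> and \<open>q\<close> has closer letters, or the same letters as
    \<open>(p, q)\<close>; the induction hypothesis covers only the first case.\<close>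
  have down: "(p, q) \<in> interior E (X \<inter> S)"
    if S: "S \<in> {Y m, Z m}" and "(p, q) \<in> S" for S
  proof (rule interior_mem[OF W(1) Suc.prems(1)])
    fix r s assume rs: "(r, s) \<in> W" "p \<le> r" "s \<le> q"
    have "(r, s) \<in> S"
    proof (cases "fst r = fst p \<and> fst s = fst q")
      case True
      have "biclosed E S" using S Y(1) Z(1) by blast
      moreover have "S \<subseteq> letter_pairs" using S Y(2) Z(2) by blast
      ultimately show ?thesis
        by (rule same_letters[where p = p and q = q])
          (use True rs \<open>(p, q) \<in> S\<close> biclosed_pairs[OF W(1)] in auto)
    next
      case False
      moreover have "fst p \<le> fst r" "fst s \<le> fst q" using rs by (auto simp: less_eq_prod_def)
      ultimately have "fst s \<le> fst r + m" using Suc.prems(2) by auto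
      then show ?thesis using Suc.IH[OF rs(1)] S by auto
    qed
    then show "(r, s) \<in> X \<inter> S" using rs W(3) by blast
  qed
  obtain r s where rs: "r = p \<or> (p, r) \<in> ?R\<^sup>+ \<inter> W" "(r, s) \<in> ?R" "s = q \<or> (s, q) \<in> ?R\<^sup>+ \<inter> W"
    using trancl_link[OF W(1) R(1) _ Suc.prems(1)] W(4) Suc.prems(1) by blast
  have "fst r < fst s" using Rlt rs(2) by blast
  moreover have "fst p \<le> fst r" "fst s \<le> fst q"
    using rs(1,3) Rlt by (metis IntD1 order_less_imp_le order.refl)+
  ultimately have "fst r \<le> fst p + m" "fst q \<le> fst s + m" using Suc.prems(2) by linarith+
  then have pr: "r = p \<or> (p, r) \<in> Y m \<inter> Z m" and sq: "s = q \<or> (s, q) \<in> Y m \<inter> Z m"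
    using rs(1,3) Suc.IH by blast+
  have close: "(p, q) \<in> S" if S: "S \<in> {Y m, Z m}" and "(r, s) \<in> S" for S
  proof -
    have "biclosed E S" using S Y(1) Z(1) by auto
    note tr = biclosed_trans[OF this]
    show ?thesis using pr sq S tr that(2) by (metis IntD1 IntD2 insertE singletonD)
  qed
  have "(p, q) \<in> Y m \<or> (p, q) \<in> Z m"
    using rs(2) close Y0[of m] Z0[of m] by blast
  moreover have "(p, q) \<in> Y m \<Longrightarrow> (p, q) \<in> Z (Suc m)"
    using down[of "Y m"] Z(3)[of m] by auto
  moreover have "(p, q) \<in> Z m \<Longrightarrow> (p, q) \<in> Y (Suc m)"
    using down[of "Z m"] Y(3)[of m] by auto
  ultimately show ?case using mono by blast
qed

lemma satisfies_SD_meet_multinomial_lattice: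
  assumes "n \<ge> 1"
  shows "satisfies_SD_meet (multinomial_lattice n v) (n - 1)"
  unfolding satisfies_SD_meet_def carrier_multinomial_lattice
proof (intro ballI)
  let ?L = "multinomial_lattice n v"
  fix x y z assume xyz: "x \<in> words n v" "y \<in> words n v" "z \<in> words n v"
  interpret Lattice.lattice ?L by (rule lattice_multinomial_lattice)
  define Y where "Y m = word_inversions (y_term ?L m x y z)" for m
  define Z where "Z m = word_inversions (z_term ?L m x y z)" for m
  let ?E = "positions n v"
  define w where "w = x \<sqinter>\<^bsub>?L\<^esub> (y \<squnion>\<^bsub>?L\<^esub> z)"
  note terms = term_words[OF xyz]
  have jw: "y \<squnion>\<^bsub>?L\<^esub> z \<in> words n v" using join_word(1) xyz by blast
  have w: "w \<in> words n v" unfolding w_def using meet_word(1)[OF xyz(1) jw] .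
  have Winv: "word_inversions w =
      interior ?E (word_inversions x \<inter> (word_inversions y \<union> word_inversions z)\<^sup>+)"
    unfolding w_def meet_word(2)[OF xyz(1) jw] join_word(2)[OF xyz(2,3)] ..
  have Y: "Y 0 = word_inversions y" "Y (Suc m) = (Y 0 \<union> interior ?E (word_inversions x \<inter> Z m))\<^sup>+"
    and Z: "Z 0 = word_inversions z" "Z (Suc m) = (Z 0 \<union> interior ?E (word_inversions x \<inter> Y m))\<^sup>+"
    for m
    unfolding Y_def Z_def
    using xyz terms join_word(2) meet_word by auto
  have YZ: "biclosed ?E (Y m)" "Y m \<subseteq> letter_pairs" "biclosed ?E (Z m)" "Z m \<subseteq> letter_pairs" for m
    unfolding Y_def Z_def
    using terms biclosed_word_inversions word_inversions_letter_pairs by blast+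
  have "Y m \<subseteq> (Y 0 \<union> Z 0)\<^sup>+ \<and> Z m \<subseteq> (Y 0 \<union> Z 0)\<^sup>+" for m
  proof (induction m)
    case 0
    then show ?case by auto
  next
    case (Suc m)
    then show ?case unfolding Y(2) Z(2)
      using interior_subset[of ?E] by (intro conjI trancl_subset_of_trans) auto
  qed
  then have y_le: "y_term ?L (n - 1) x y z \<sqsubseteq>\<^bsub>?L\<^esub> y \<squnion>\<^bsub>?L\<^esub> z"
    using terms jw join_word(2)[OF xyz(2,3)] Y(1) Z(1)
    by (simp add: le_multinomial_lattice flip: Y_def)
  have "word_inversions w \<subseteq> Y (n - 1)"
  proof (rule subrelI)
    fix p q assume pq: "(p, q) \<in> word_inversions w"
    then have "p \<in> ?E" "q \<in> ?E" using biclosed_pairs[OF biclosed_word_inversions[OF w]] by auto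
    then have "fst q \<le> fst p + (n - 1)" by (auto simp: positions_def)
    with pq have "(p, q) \<in> Y (n - 1) \<inter> Z (n - 1)"
      by (intro meet_join_below_terms[where X = "word_inversions x" and W = "word_inversions w"
            and E = ?E] biclosed_word_inversions w word_inversions_letter_pairs YZ Y(2) Z(2))
        (use interior_subset[of ?E] in \<open>auto simp: Winv Y(1) Z(1)\<close>)
    then show "(p, q) \<in> Y (n - 1)" by blast
  qed
  then have "w \<sqsubseteq>\<^bsub>?L\<^esub> y_term ?L (n - 1) x y z"
    using terms w by (simp add: le_multinomial_lattice Y_def)
  moreover have "w \<sqsubseteq>\<^bsub>?L\<^esub> x" unfolding w_def using xyz jw by (intro meet_left) auto
  ultimately have 1: "w \<sqsubseteq>\<^bsub>?L\<^esub> x \<sqinter>\<^bsub>?L\<^esub> y_term ?L (n - 1) x y z"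
    using xyz terms w by (intro meet_le) auto
  have m: "x \<sqinter>\<^bsub>?L\<^esub> y_term ?L (n - 1) x y z \<in> words n v" using meet_word(1) xyz terms by blast
  have "x \<sqinter>\<^bsub>?L\<^esub> y_term ?L (n - 1) x y z \<sqsubseteq>\<^bsub>?L\<^esub> y \<squnion>\<^bsub>?L\<^esub> z"
    using y_le meet_right[of x "y_term ?L (n - 1) x y z"] xyz terms jw m le_trans
    by (metis carrier_multinomial_lattice)
  then have 2: "x \<sqinter>\<^bsub>?L\<^esub> y_term ?L (n - 1) x y z \<sqsubseteq>\<^bsub>?L\<^esub> w"
    unfolding w_def using xyz terms jw m by (intro meet_le meet_left) auto
  show "x \<sqinter>\<^bsub>?L\<^esub> y_term ?L (n - 1) x y z = x \<sqinter>\<^bsub>?L\<^esub> (y \<squnion>\<^bsub>?L\<^esub> z)"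
    using le_antisym[OF 2 1] m w unfolding w_def by auto
qed

section \<open>The equation fails at n - 2\<close>

text \<open>The inversions of the element \<open>x\<close> of the counterexample: the letter \<open>1\<close> stands last and the others
  are in increasing order. The links below are the inversions of \<open>y\<close> and \<open>z\<close>, for a predicate
  \<open>P\<close> which selects one parity.\<close>

definition star_pairs :: "(nat \<times> nat) set \<Rightarrow> ((nat \<times> nat) \<times> (nat \<times> nat)) set" where
  "star_pairs E = {(p, q). p \<in> E \<and> q \<in> E \<and> fst p = 1 \<and> 1 < fst q}"

definition link_pairs :: "(nat \<times> nat) set \<Rightarrow> (nat \<Rightarrow> bool) \<Rightarrow> ((nat \<times> nat) \<times> (nat \<times> nat)) set" where
  "link_pairs E P = {(p, q). p \<in> E \<and> q \<in> E \<and> fst q = Suc (fst p) \<and> P (fst p)}"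

lemma biclosed_star_pairs:
  assumes "\<And>p. p \<in> E \<Longrightarrow> 1 \<le> fst p"
  shows "biclosed E (star_pairs E)"
proof (rule biclosedI)
  fix p q r
  assume "(p, r) \<in> star_pairs E" "q \<in> E" "p < q" "q < r"
  then show "(p, q) \<in> star_pairs E \<or> (q, r) \<in> star_pairs E"
    using assms[of q] by (auto simp: star_pairs_def)
qed (auto simp: star_pairs_def increasing_pairs_def less_prod_def)

lemma biclosed_link_pairs:
  assumes "\<And>i. P i \<Longrightarrow> \<not> P (Suc i)"
  shows "biclosed E (link_pairs E P)"
proof (rule biclosedI)
  fix p q r
  assume "(p, r) \<in> link_pairs E P" "q \<in> E" "p < q" "q < r"
  then have "fst q = fst p \<or> fst q = fst r" by (auto simp: link_pairs_def less_prod_def)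
  then show "(p, q) \<in> link_pairs E P \<or> (q, r) \<in> link_pairs E P"
    using \<open>(p, r) \<in> link_pairs E P\<close> \<open>q \<in> E\<close> by (auto simp: link_pairs_def)
qed (use assms in \<open>auto simp: link_pairs_def increasing_pairs_def less_prod_def\<close>)

text \<open>An upper bound for the inversions of the \<open>m\<close>-th term that starts from the links selected by \<open>P\<close>. The
  letter \<open>1\<close> may be inverted with letters up to \<open>m + 1\<close>, and with \<open>m + 2\<close> only if the last link has
  the parity of the term itself. That parity condition is what makes the bound
  transitive: no link of the same parity continues from \<open>m + 2\<close>.\<close>

definition reach_bound :: "(nat \<Rightarrow> bool) \<Rightarrow> nat \<Rightarrow> ((nat \<times> nat) \<times> (nat \<times> nat)) set" where
  "reach_bound P m = {(p, q). 1 \<le> fst p \<and> fst q = Suc (fst p) \<and> P (fst p) \<or>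
    fst p = 1 \<and> (fst q \<le> m + 1 \<or> fst q = m + 2 \<and> P (m + 1))}"

lemma trans_reach_bound:
  assumes "\<And>i. P i \<Longrightarrow> \<not> P (Suc i)"
  shows "trans (reach_bound P m)"
proof (rule transI)
  fix p q r assume "(p, q) \<in> reach_bound P m" "(q, r) \<in> reach_bound P m"
  then show "(p, r) \<in> reach_bound P m"
    using assms[of "fst p"] assms[of "m + 1"] unfolding reach_bound_def
    by (auto simp: le_Suc_eq)
qed

text \<open>The meet with \<open>x\<close> retains only pairs that start at letter \<open>1\<close>; for these the parity condition of the
  other sequence can be forgotten, at the cost of one step.\<close>

lemma reach_bound_Suc:
  assumes "S \<subseteq> reach_bound Q m"
  shows "interior E (star_pairs E \<inter> S) \<subseteq> reach_bound P (Suc m)"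
proof -
  have "star_pairs E \<inter> reach_bound Q m \<subseteq> reach_bound P (Suc m)"
    by (auto simp: star_pairs_def reach_bound_def)
  then show ?thesis using assms interior_subset[of E "star_pairs E \<inter> S"] by blast
qed

lemma star_pairs_subset:
  assumes ne: "\<And>i. 1 \<le> i \<Longrightarrow> i \<le> n \<Longrightarrow> \<exists>k. (i, k) \<in> E"
    and bd: "\<And>p. p \<in> E \<Longrightarrow> fst p \<le> n"
  shows "star_pairs E \<subseteq> (link_pairs E P \<union> link_pairs E (\<lambda>i. \<not> P i))\<^sup>+"
proof (rule subrelI)
  let ?R = "link_pairs E P \<union> link_pairs E (\<lambda>i. \<not> P i)"
  have R: "(p, q) \<in> ?R" if "p \<in> E" "q \<in> E" "fst q = Suc (fst p)" for p q
    using that by (auto simp: link_pairs_def)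
  fix p q assume "(p, q) \<in> star_pairs E"
  then have p: "p \<in> E" "fst p = 1" and q: "q \<in> E" "1 < fst q" by (auto simp: star_pairs_def)
  have "(p, q) \<in> ?R\<^sup>+" if "q \<in> E" "fst q = i + 2" for i q
    using that
  proof (induction i arbitrary: q)
    case 0
    then show ?case using R[OF p(1), of q] p(2) by (intro r_into_trancl) simp
  next
    case (Suc i)
    have "i + 2 \<le> n" using bd[OF Suc.prems(1)] Suc.prems(2) by auto
    then obtain k where k: "(i + 2, k) \<in> E" using ne[of "i + 2"] by auto
    then have "(p, (i + 2, k)) \<in> ?R\<^sup>+" using Suc.IH by auto
    moreover have "((i + 2, k), q) \<in> ?R" using R k Suc.prems by auto
    ultimately show ?case by (rule trancl_into_trancl)
  qed
  then show "(p, q) \<in> ?R\<^sup>+" using q by (metis Suc_1 Suc_leI le_add_diff_inverse2)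
qed

lemma not_satisfies_SD_meet_multinomial_lattice:
  assumes n: "n \<ge> 2" and v: "\<And>i. i \<in> {1..n} \<Longrightarrow> v i > 0"
  shows "\<not> satisfies_SD_meet (multinomial_lattice n v) (n - 2)"
proof
  let ?L = "multinomial_lattice n v" and ?E = "positions n v"
  assume SD: "satisfies_SD_meet ?L (n - 2)"
  \<comment> \<open>The parity is chosen such that the link from \<open>n - 1\<close> to \<open>n\<close> belongs to \<open>z\<close>.\<close>
  define P where "P i = even (n + i)" for i
  have P: "P i \<Longrightarrow> \<not> P (Suc i)" "\<not> P i \<Longrightarrow> \<not> \<not> P (Suc i)" for i by (auto simp: P_def)
  have lp: "star_pairs ?E \<subseteq> letter_pairs" "link_pairs ?E R \<subseteq> letter_pairs" for R
    by (auto simp: star_pairs_def link_pairs_def letter_pairs_def)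
  obtain x where x: "x \<in> words n v" "word_inversions x = star_pairs ?E"
    by (rule ex_word_inversions[OF biclosed_star_pairs lp(1)]) (auto simp: positions_def)
  obtain y where y: "y \<in> words n v" "word_inversions y = link_pairs ?E P"
    using ex_word_inversions[OF biclosed_link_pairs lp(2)] P(1) by metis
  obtain z where z: "z \<in> words n v" "word_inversions z = link_pairs ?E (\<lambda>i. \<not> P i)"
    using ex_word_inversions[OF biclosed_link_pairs lp(2), of "\<lambda>i. \<not> P i"] P(2) by metis
  note terms = term_words[OF x(1) y(1) z(1)]
  have bound: "word_inversions (y_term ?L m x y z) \<subseteq> reach_bound P m \<and>
      word_inversions (z_term ?L m x y z) \<subseteq> reach_bound (\<lambda>i. \<not> P i) m" for m
  proof (induction m)
    case 0
    then show ?case using y z by (auto simp: link_pairs_def reach_bound_def positions_def)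
  next
    case (Suc m)
    have base: "link_pairs ?E R \<subseteq> reach_bound R k" for R k
      by (auto simp: link_pairs_def reach_bound_def positions_def)
    have "word_inversions (y_term ?L (Suc m) x y z) \<subseteq> reach_bound P (Suc m)"
      using reach_bound_Suc[OF conjunct2[OF Suc.IH]] base x y terms
      by (simp add: join_word(2) meet_word, intro trancl_subset_of_trans trans_reach_bound P(1)) auto
    moreover have "word_inversions (z_term ?L (Suc m) x y z) \<subseteq> reach_bound (\<lambda>i. \<not> P i) (Suc m)"
      using reach_bound_Suc[OF conjunct1[OF Suc.IH]] base x z terms
      by (simp add: join_word(2) meet_word, intro trancl_subset_of_trans trans_reach_bound P(2)) auto
    ultimately show ?case by blast
  qed
  have jw: "y \<squnion>\<^bsub>?L\<^esub> z \<in> words n v" using join_word(1) y(1) z(1) by blast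
  have ends: "((1, 0), (n, 0)) \<in> star_pairs ?E"
    using n v[of 1] v[of n] by (auto simp: star_pairs_def positions_def)
  have "star_pairs ?E \<subseteq> (word_inversions y \<union> word_inversions z)\<^sup>+"
    unfolding y(2) z(2) by (rule star_pairs_subset[of n]) (use v in \<open>auto simp: positions_def\<close>)
  then have "star_pairs ?E \<subseteq> word_inversions (x \<sqinter>\<^bsub>?L\<^esub> (y \<squnion>\<^bsub>?L\<^esub> z))"
    unfolding meet_word(2)[OF x(1) jw] join_word(2)[OF y(1) z(1)] x(2)
    by (intro interior_greatest) (use biclosed_word_inversions[OF x(1)] x(2) in auto)
  also have "x \<sqinter>\<^bsub>?L\<^esub> (y \<squnion>\<^bsub>?L\<^esub> z) = x \<sqinter>\<^bsub>?L\<^esub> y_term ?L (n - 2) x y z"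
    using SD x(1) y(1) z(1) unfolding satisfies_SD_meet_def by auto
  also have "word_inversions \<dots> \<subseteq> word_inversions (y_term ?L (n - 2) x y z)"
    unfolding meet_word(2)[OF x(1) terms(1)] using interior_subset by blast
  finally have "((1, 0), (n, 0)) \<in> reach_bound P (n - 2)" using ends bound by blast
  then have "P (Suc (n - 2))" using n by (auto simp: reach_bound_def)
  then show False using n by (auto simp: P_def)
qed

theorem mainTheorem1:
  fixes n :: nat and v :: "nat \<Rightarrow> nat"
  assumes "n \<ge> 2"
    and "\<And>i. i \<in> {1..n} \<Longrightarrow> v i > 0"
  shows "Lattice.lattice (multinomial_lattice n v) \<and>
    satisfies_SD_meet (multinomial_lattice n v) (n - 1) \<and>
    \<not> satisfies_SD_meet (multinomial_lattice n v) (n - 2)"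
  using lattice_multinomial_lattice satisfies_SD_meet_multinomial_lattice[of n v]
    not_satisfies_SD_meet_multinomial_lattice[OF assms] assms(1) by simp

end
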